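(* Let $\Omega\subset\mathbf{R}^N$ be a bounded domain with smooth boundary $\partial\Omega$ and outer unit normal $\nu$, let $D,\tau,\alpha_1,\alpha_2>0$ be constants, and let $u_0,v_0$ be smooth nonnegative functions on $\overline\Omega$. Put $$f(u,v)=-\alpha_1\left[\frac{u+v}{(\alpha_2(u+v)+1)^2}-v\right].$$ Let $(u,v)=(u(\cdot,t),v(\cdot,t))$ be the classical solution of $$u_t=D\Delta u+f(u,v),\quad \tau v_t=\Delta v-f(u,v)\quad\text{in }\Omega\times(0,T),$$ $$\frac{\partial u}{\partial\nu}=\frac{\partial v}{\partial\nu}=0\ \text{ on }\partial\Omega,\qquad (u,v)|_{t=0}=(u_0,v_0),$$ where $[0,T)$ is its interval of existence. Then $$u(\cdot,t)\ge 0,\quad v(\cdot,t)\geq 0\quad\text{on }\overline\Omega\quad\text{for all } t\in[0,T).$$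
   Context: Standard parabolic theory gives a unique local-in-time classical solution of the initial-boundary value problem; $T\in(0,+\infty]$ denotes its existence time. *)

theory Defs
  imports "HOL-Analysis.Analysis"
begin

subsection \<open>Smooth functions and domains with smooth boundary\<close>

definition dir_deriv :: "'a::euclidean_space \<Rightarrow> ('a \<Rightarrow> real) \<Rightarrow> 'a \<Rightarrow> real" where
  "dir_deriv b g x = frechet_derivative g (at x) b"

definition laplacian :: "('a::euclidean_space \<Rightarrow> real) \<Rightarrow> 'a \<Rightarrow> real" where
  "laplacian g x = (\<Sum>b\<in>Basis. dir_deriv b (dir_deriv b g) x)"

text \<open>Only used for open \<^term>\<open>S\<close>, where it is the class \<open>C^k\<close>.\<close>

primrec Ck_on :: "nat \<Rightarrow> ('a::euclidean_space \<Rightarrow> real) \<Rightarrow> 'a set \<Rightarrow> bool" where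
  "Ck_on 0 g S \<longleftrightarrow> continuous_on S g"
| "Ck_on (Suc k) g S \<longleftrightarrow> (\<forall>x\<in>S. g differentiable (at x)) \<and> (\<forall>b\<in>Basis. Ck_on k (dir_deriv b g) S)"

definition smooth_on_open :: "('a::euclidean_space \<Rightarrow> real) \<Rightarrow> 'a set \<Rightarrow> bool" where
  "smooth_on_open g U \<longleftrightarrow> open U \<and> (\<forall>k. Ck_on k g U)"

text \<open>On a closed set, smoothness means having a smooth extension to an open neighbourhood.\<close>

definition smooth_on_closed :: "('a::euclidean_space \<Rightarrow> real) \<Rightarrow> 'a set \<Rightarrow> bool" where
  "smooth_on_closed g K \<longleftrightarrow> (\<exists>U h. K \<subseteq> U \<and> smooth_on_open h U \<and> (\<forall>x\<in>K. h x = g x))"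

text \<open>A local defining function with gradient \<^term>\<open>w\<close> at the boundary point \<^term>\<open>x\<close>. As the function is
  negative inside, \<^term>\<open>w\<close> is normal to the boundary and points outwards.\<close>

definition local_defining_function ::
  "'a::euclidean_space set \<Rightarrow> 'a \<Rightarrow> ('a \<Rightarrow> real) \<Rightarrow> 'a \<Rightarrow> bool" where
  "local_defining_function \<Omega> x \<phi> w \<longleftrightarrow>
     (\<exists>U. x \<in> U \<and> smooth_on_open \<phi> U \<and>
          \<Omega> \<inter> U = {y\<in>U. \<phi> y < 0} \<and> frontier \<Omega> \<inter> U = {y\<in>U. \<phi> y = 0}) \<and>
     (GDERIV \<phi> x :> w) \<and> w \<noteq> 0"

definition bounded_smooth_domain :: "'a::euclidean_space set \<Rightarrow> bool" where
  "bounded_smooth_domain \<Omega> \<longleftrightarrow>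
     open \<Omega> \<and> connected \<Omega> \<and> \<Omega> \<noteq> {} \<and> bounded \<Omega> \<and>
     (\<forall>x\<in>frontier \<Omega>. \<exists>\<phi> w. local_defining_function \<Omega> x \<phi> w)"

definition outer_unit_normal :: "'a::euclidean_space set \<Rightarrow> ('a \<Rightarrow> 'a) \<Rightarrow> bool" where
  "outer_unit_normal \<Omega> \<nu> \<longleftrightarrow>
     (\<forall>x\<in>frontier \<Omega>. \<exists>\<phi> w. local_defining_function \<Omega> x \<phi> w \<and> \<nu> x = w /\<^sub>R norm w)"

text \<open>The derivative at a boundary point is taken relative to the closure of the domain, so
  values of \<^term>\<open>g\<close> outside the closure are irrelevant.\<close>

definition has_normal_derivative ::
  "'a::euclidean_space set \<Rightarrow> ('a \<Rightarrow> 'a) \<Rightarrow> ('a \<Rightarrow> real) \<Rightarrow> 'a \<Rightarrow> real \<Rightarrow> bool" where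
  "has_normal_derivative \<Omega> \<nu> g x d \<longleftrightarrow>
     (\<exists>g'. (g has_derivative g') (at x within closure \<Omega>) \<and> g' (\<nu> x) = d)"

subsection \<open>Classical solutions\<close>

text \<open>The value at the pole \<open>\<alpha>2 * (u + v) = - 1\<close> is the junk value from division by zero. Solutions are not
  required to avoid the pole, which they cannot meet while \<^term>\<open>u\<close> and \<^term>\<open>v\<close> are nonnegative.\<close>

definition reaction :: "real \<Rightarrow> real \<Rightarrow> real \<Rightarrow> real \<Rightarrow> real" where
  "reaction \<alpha>1 \<alpha>2 u v = - \<alpha>1 * ((u + v) / (\<alpha>2 * (u + v) + 1)\<^sup>2 - v)"

definition extends_to_closure ::
  "'a::euclidean_space set \<Rightarrow> real set \<Rightarrow> ('a \<Rightarrow> real \<Rightarrow> real) \<Rightarrow> bool" where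
  "extends_to_closure \<Omega> I F \<longleftrightarrow>
     (\<exists>G. continuous_on (closure \<Omega> \<times> I) G \<and> (\<forall>x\<in>\<Omega>. \<forall>t\<in>I. G (x, t) = F x t))"

text \<open>Twice continuously differentiable in space and once in time, with these derivatives continuous
  up to the lateral boundary; \<^term>\<open>I\<close> is meant to be an open interval.\<close>

definition C21 :: "'a::euclidean_space set \<Rightarrow> real set \<Rightarrow> ('a \<Rightarrow> real \<Rightarrow> real) \<Rightarrow> bool" where
  "C21 \<Omega> I u \<longleftrightarrow>
     (\<forall>x\<in>\<Omega>. \<forall>t\<in>I.
        (\<lambda>s. u x s) differentiable (at t) \<and>
        (\<lambda>y. u y t) differentiable (at x) \<and>
        (\<forall>b\<in>Basis. dir_deriv b (\<lambda>y. u y t) differentiable (at x))) \<and>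
     extends_to_closure \<Omega> I u \<and>
     extends_to_closure \<Omega> I (\<lambda>x t. deriv (\<lambda>s. u x s) t) \<and>
     (\<forall>b\<in>Basis. extends_to_closure \<Omega> I (\<lambda>x t. dir_deriv b (\<lambda>y. u y t) x)) \<and>
     (\<forall>b\<in>Basis. \<forall>c\<in>Basis.
        extends_to_closure \<Omega> I (\<lambda>x t. dir_deriv c (dir_deriv b (\<lambda>y. u y t)) x))"

definition classical_solution ::
  "'a::euclidean_space set \<Rightarrow> ('a \<Rightarrow> 'a) \<Rightarrow> real \<Rightarrow> real \<Rightarrow> real \<Rightarrow> real \<Rightarrow> ('a \<Rightarrow> real) \<Rightarrow> ('a \<Rightarrow> real) \<Rightarrow>
   ereal \<Rightarrow> ('a \<Rightarrow> real \<Rightarrow> real) \<Rightarrow> ('a \<Rightarrow> real \<Rightarrow> real) \<Rightarrow> bool" where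
  "classical_solution \<Omega> \<nu> D \<tau> \<alpha>1 \<alpha>2 u\<^sub>0 v\<^sub>0 T u v \<longleftrightarrow>
     (\<forall>w\<in>{u, v}.
        continuous_on (closure \<Omega> \<times> {t. 0 \<le> t \<and> ereal t < T}) (\<lambda>(x, t). w x t) \<and>
        C21 \<Omega> {t. 0 < t \<and> ereal t < T} w) \<and>
     (\<forall>x\<in>\<Omega>. \<forall>t. 0 < t \<and> ereal t < T \<longrightarrow>
        deriv (\<lambda>s. u x s) t = D * laplacian (\<lambda>y. u y t) x + reaction \<alpha>1 \<alpha>2 (u x t) (v x t) \<and>
        \<tau> * deriv (\<lambda>s. v x s) t = laplacian (\<lambda>y. v y t) x - reaction \<alpha>1 \<alpha>2 (u x t) (v x t)) \<and>
     (\<forall>x\<in>frontier \<Omega>. \<forall>t. 0 < t \<and> ereal t < T \<longrightarrow>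
        has_normal_derivative \<Omega> \<nu> (\<lambda>y. u y t) x 0 \<and>
        has_normal_derivative \<Omega> \<nu> (\<lambda>y. v y t) x 0) \<and>
     (\<forall>x\<in>closure \<Omega>. u x 0 = u\<^sub>0 x \<and> v x 0 = v\<^sub>0 x)"

end

theory Submission
  imports Defs
begin

text \<open>The reaction is quasi-positive: \<open>f(0,v) \<ge> 0\<close> for \<open>v \<ge> 0\<close> and \<open>- f(u,0) \<ge> 0\<close> for \<open>u \<ge> 0\<close>, so the
  vector field never points out of the quadrant. The data may vanish, hence the maximum principle is
  applied to the strictly positive perturbations \<open>u + p\<close> and \<open>v + p\<close> with \<open>p t = \<epsilon> exp (K t)\<close>. If one
  of them reaches \<open>0\<close>, say \<open>u + p\<close>, consider the first time \<open>t\<close> and a point \<open>x\<close> of the closed domain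
  where it does. Then \<open>u\<^sub>t \<le> - p' = - K p\<close> and \<open>\<Delta>u \<ge> 0\<close> there, so the equation gives
  \<open>f(- p, v) \<le> - K p\<close> with \<open>v \<ge> - p\<close>. Near the quadrant, quasi-positivity degrades only linearly:
  \<open>f(- p, v) \<ge> - \<alpha>1 p\<close>, and \<open>f(u, - p) \<le> 7 \<alpha>1 p\<close> for the other component as long as \<open>p\<close> is small. Both
  bounds are uniform in the other unknown. A large \<open>K\<close> therefore excludes the touching, and
  \<open>\<epsilon> \<rightarrow> 0\<close> gives the claim.

  The point \<open>x\<close> may lie on the boundary. There the equation holds for the limits of the derivatives,
  and the sign of the Laplacian is found without a barrier function. At a boundary minimum the
  derivative is nonnegative in inward directions; together with the Neumann condition this forces the
  whole gradient to vanish. Along an inward ray the second-order term must then be nonnegative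
  (\<open>hessian_limit_nonneg_on_inward_ray\<close>). These directions fill an open half-space, and a quadratic form
  is even and continuous, so it is nonnegative everywhere and has nonnegative trace
  (\<open>laplacian_limit_nonneg_at_neumann_minimum\<close>). Interior points are covered by the same argument,
  since from them every direction stays in the domain for a short time.\<close>

section \<open>Second-order conditions at a minimum on the closed domain\<close>

text \<open>If \<open>L < 0\<close>, the function is strictly concave near \<open>0\<close>. Its difference quotients at \<open>0\<close> then exceed some
  \<open>m > 0\<close>, because \<open>g \<ge> g 0\<close> makes the slope nonnegative somewhere and concavity makes it larger
  closer to \<open>0\<close>. This contradicts the vanishing right derivative. Only one-sided data at \<open>0\<close> enter,
  as needed for rays that start on the boundary.\<close>

lemma second_derivative_limit_nonneg:
  fixes g g' g'' :: "real \<Rightarrow> real"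
  assumes "0 < r"
    and g': "\<And>s. 0 < s \<Longrightarrow> s < r \<Longrightarrow> (g has_real_derivative g' s) (at s)"
    and g'': "\<And>s. 0 < s \<Longrightarrow> s < r \<Longrightarrow> (g' has_real_derivative g'' s) (at s)"
    and lim: "(g'' \<longlongrightarrow> L) (at_right 0)"
    and der0: "(g has_real_derivative 0) (at_right 0)"
    and le: "\<And>s. 0 < s \<Longrightarrow> s < r \<Longrightarrow> g 0 \<le> g s"
  shows "0 \<le> L"
proof (rule ccontr)
  assume "\<not> 0 \<le> L"
  then have "eventually (\<lambda>s. g'' s < 0) (at_right 0)"
    using order_tendstoD(2)[OF lim, of 0] by simp
  then obtain d where d: "0 < d" "\<And>s. 0 < s \<Longrightarrow> s < d \<Longrightarrow> g'' s < 0"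
    by (auto simp: eventually_at_right_field)
  define e where "e = min d r"
  have e: "0 < e" "e \<le> d" "e \<le> r"
    using d(1) \<open>0 < r\<close> by (auto simp: e_def)
  have decr: "g' b < g' a" if "0 < a" "a < b" "b < e" for a b
  proof (rule DERIV_neg_imp_decreasing[OF \<open>a < b\<close>])
    fix y assume "a \<le> y" "y \<le> b"
    then have "0 < y" "y < d" "y < r" using that e by auto
    then show "\<exists>l. (g' has_real_derivative l) (at y) \<and> l < 0" using g'' d(2) by blast
  qed
  have cont0: "(g \<longlongrightarrow> g 0) (at_right 0)"
    using has_derivative_continuous[OF der0[unfolded has_field_derivative_def]]
    by (simp add: continuous_within)
  have mvt: "\<exists>z. 0 < z \<and> z < s \<and> g s - g 0 = s * g' z" if s: "0 < s" "s < e" for s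
  proof -
    have "continuous_on {0..s} g"
      unfolding continuous_on_eq_continuous_within
    proof
      fix x assume x: "x \<in> {0..s}"
      show "continuous (at x within {0..s}) g"
      proof (cases "x = 0")
        case True
        then show ?thesis
          using cont0 s by (simp add: continuous_within at_within_Icc_at_right)
      next
        case False
        with x s e have "isCont g x"
          by (intro DERIV_isCont[OF g']) auto
        then show ?thesis by (rule continuous_at_imp_continuous_at_within)
      qed
    qed
    moreover have "g differentiable (at x)" if "0 < x" "x < s" for x
      using g'[of x] that s e by (auto simp: real_differentiable_def)
    ultimately obtain l z where z: "0 < z" "z < s" "(g has_real_derivative l) (at z)"
      "g s - g 0 = (s - 0) * l"
      using MVT[OF s(1), of g] by blast
    moreover have "l = g' z"
      using DERIV_unique[OF z(3) g'] z(1,2) s e by simp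
    ultimately show ?thesis by auto
  qed
  obtain z where z: "0 < z" "z < e / 2" "g (e/2) - g 0 = e/2 * g' z"
    using mvt[of "e/2"] e by auto
  have "0 \<le> e/2 * g' z" using le[of "e/2"] e z by simp
  then have "0 \<le> g' z" using e by (simp add: zero_le_mult_iff)
  define m where "m = g' (z/2)"
  have m: "0 < m" using decr[of "z/2" z] z \<open>0 \<le> g' z\<close> e by (simp add: m_def)
  have "m \<le> (g s - g 0) / s" if s: "0 < s" "s < z/2" for s
  proof -
    obtain q where q: "0 < q" "q < s" "g s - g 0 = s * g' q"
      using mvt[of s] s z e by auto
    then have "m < g' q" unfolding m_def using decr[of q "z/2"] s z e by auto
    with q s show ?thesis by (simp add: field_simps)
  qed
  then have "eventually (\<lambda>s. m \<le> (g s - g 0) / s) (at_right 0)"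
    using z by (auto simp: eventually_at_right_field intro!: exI[of _ "z/2"])
  moreover have "((\<lambda>s. (g s - g 0) / s) \<longlongrightarrow> 0) (at_right 0)"
    using der0 by (simp add: has_field_derivative_iff)
  ultimately have "m \<le> 0"
    by (intro tendsto_lowerbound[of _ 0 "at_right (0::real)"]) auto
  with m show False by simp
qed

lemma inward_ray_in_domain:
  assumes "local_defining_function \<Omega> x \<phi> w" "x \<in> frontier \<Omega>" "w \<bullet> \<xi> < 0"
  shows "eventually (\<lambda>s. x + s *\<^sub>R \<xi> \<in> \<Omega>) (at_right 0)"
proof -
  obtain U where U: "x \<in> U" "open U" "\<Omega> \<inter> U = {y\<in>U. \<phi> y < 0}" "frontier \<Omega> \<inter> U = {y\<in>U. \<phi> y = 0}"
    and D: "(\<phi> has_derivative (\<lambda>h. w \<bullet> h)) (at x)"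
    using assms(1) by (auto simp: local_defining_function_def smooth_on_open_def gderiv_def inner_commute)
  have \<phi>0: "\<phi> x = 0" using U assms(2) by auto
  have "((\<lambda>s. \<phi> (x + s *\<^sub>R \<xi>)) has_derivative (\<lambda>h. w \<bullet> (h *\<^sub>R \<xi>))) (at 0)"
    by (rule has_derivative_compose[where f="\<lambda>s. x + s *\<^sub>R \<xi>" and g=\<phi>])
      (auto intro!: derivative_eq_intros D)
  then have "((\<lambda>s. \<phi> (x + s *\<^sub>R \<xi>)) has_real_derivative (w \<bullet> \<xi>)) (at 0)"
    by (simp add: has_field_derivative_def mult_commute_abs)
  from DERIV_neg_dec_right[OF this \<open>w \<bullet> \<xi> < 0\<close>]
  obtain d where d: "0 < d" "\<And>h. 0 < h \<Longrightarrow> h < d \<Longrightarrow> \<phi> (x + h *\<^sub>R \<xi>) < 0"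
    by (auto simp: \<phi>0)
  have "((\<lambda>s. x + s *\<^sub>R \<xi>) \<longlongrightarrow> x + 0 *\<^sub>R \<xi>) (at_right 0)"
    by (intro tendsto_intros)
  then have "eventually (\<lambda>s. x + s *\<^sub>R \<xi> \<in> U) (at_right 0)"
    using U by (auto dest: topological_tendstoD)
  moreover have "eventually (\<lambda>s. \<phi> (x + s *\<^sub>R \<xi>) < 0) (at_right 0)"
    using d by (auto simp: eventually_at_right_field)
  ultimately show ?thesis
    by eventually_elim (use U(3) in auto)
qed

text \<open>Treats boundary and interior points alike. In the interior every direction is admissible and \<open>w\<close> is
  arbitrary; on the boundary \<open>w\<close> is the gradient of a defining function.\<close>

lemma inward_cone_exists:
  fixes \<Omega> :: "'a::euclidean_space set"
  assumes "open \<Omega>" "outer_unit_normal \<Omega> \<nu>" "x \<in> closure \<Omega>"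
  obtains w where "w \<noteq> 0" "x \<in> frontier \<Omega> \<Longrightarrow> \<nu> x = w /\<^sub>R norm w"
    "\<And>\<xi>. w \<bullet> \<xi> < 0 \<Longrightarrow> eventually (\<lambda>s. x + s *\<^sub>R \<xi> \<in> \<Omega>) (at_right 0)"
proof (cases "x \<in> \<Omega>")
  case True
  obtain w :: 'a where w: "w \<in> Basis" using nonempty_Basis by blast
  have "eventually (\<lambda>s. x + s *\<^sub>R \<xi> \<in> \<Omega>) (at_right 0)" for \<xi>
  proof -
    have "((\<lambda>s. x + s *\<^sub>R \<xi>) \<longlongrightarrow> x + 0 *\<^sub>R \<xi>) (at_right 0)"
      by (intro tendsto_intros)
    then show ?thesis using True \<open>open \<Omega>\<close> by (auto dest: topological_tendstoD)
  qed
  moreover have "x \<notin> frontier \<Omega>" using True \<open>open \<Omega>\<close> by (simp add: frontier_def interior_open)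
  ultimately show ?thesis by (intro that[of w]) (use w in auto)
next
  case False
  then have x: "x \<in> frontier \<Omega>"
    using assms by (simp add: frontier_def interior_open)
  then obtain \<phi> w where "local_defining_function \<Omega> x \<phi> w" "\<nu> x = w /\<^sub>R norm w"
    using assms(2) by (auto simp: outer_unit_normal_def)
  then show ?thesis
    using that[of w] inward_ray_in_domain[OF _ x] by (auto simp: local_defining_function_def)
qed

lemma ray_derivative_at_right:
  fixes f :: "'a::euclidean_space \<Rightarrow> real"
  assumes "(f has_derivative A) (at x within closure \<Omega>)"
    and ray: "eventually (\<lambda>s. x + s *\<^sub>R \<xi> \<in> \<Omega>) (at_right 0)"
  shows "((\<lambda>s. f (x + s *\<^sub>R \<xi>)) has_real_derivative A \<xi>) (at_right 0)"
proof -
  interpret A: bounded_linear A using assms(1) by (rule has_derivative_bounded_linear)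
  obtain d where d: "0 < d" "\<And>s. 0 < s \<Longrightarrow> s < d \<Longrightarrow> x + s *\<^sub>R \<xi> \<in> \<Omega>"
    using ray by (auto simp: eventually_at_right_field)
  let ?S = "{0<..<d}"
  have sub: "(\<lambda>s. x + s *\<^sub>R \<xi>) ` ?S \<subseteq> closure \<Omega>"
    using d closure_subset by fastforce
  have "((\<lambda>s. f (x + s *\<^sub>R \<xi>)) has_derivative (\<lambda>h. A (h *\<^sub>R \<xi>))) (at 0 within ?S)"
    by (rule has_derivative_in_compose[where f="\<lambda>s. x + s *\<^sub>R \<xi>" and g=f])
      (use has_derivative_subset[OF assms(1) sub] in \<open>auto intro!: derivative_eq_intros\<close>)
  then have "((\<lambda>s. f (x + s *\<^sub>R \<xi>)) has_real_derivative A \<xi>) (at 0 within ?S)"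
    by (simp add: has_field_derivative_def A.scaleR mult_commute_abs)
  moreover have "at 0 within ?S = at_right 0"
    using d(1) by (intro at_within_nhd[of _ "{..<d}"]) auto
  ultimately show ?thesis by simp
qed

text \<open>At a boundary point, minimality gives \<open>A \<xi> \<ge> 0\<close> for the derivative \<open>A\<close> and inward \<open>\<xi>\<close>. Every direction
  becomes inward after subtracting a multiple of the normal, which \<open>A\<close> annihilates. Hence \<open>A\<close> is
  nonnegative in all directions, and being linear it is zero.\<close>

lemma derivative_zero_at_neumann_minimum:
  fixes f :: "'a::euclidean_space \<Rightarrow> real"
  assumes "open \<Omega>" "outer_unit_normal \<Omega> \<nu>" "x \<in> closure \<Omega>"
    and min: "\<And>y. y \<in> closure \<Omega> \<Longrightarrow> f x \<le> f y"
    and diff: "x \<in> \<Omega> \<Longrightarrow> f differentiable (at x)"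
    and neumann: "x \<in> frontier \<Omega> \<Longrightarrow> has_normal_derivative \<Omega> \<nu> f x 0"
  shows "(f has_derivative (\<lambda>h. 0)) (at x within closure \<Omega>)"
proof (cases "x \<in> \<Omega>")
  case True
  then obtain A where A: "(f has_derivative A) (at x)"
    using diff by (auto simp: differentiable_def)
  have "A = (\<lambda>h. 0)"
    by (rule differential_zero_maxmin[OF True \<open>open \<Omega>\<close> A])
      (use min closure_subset in blast)
  with A show ?thesis using has_derivative_at_withinI by blast
next
  case False
  then have x: "x \<in> frontier \<Omega>"
    using assms by (simp add: frontier_def interior_open)
  obtain A where A: "(f has_derivative A) (at x within closure \<Omega>)" "A (\<nu> x) = 0"
    using neumann[OF x] by (auto simp: has_normal_derivative_def)
  interpret A: bounded_linear A using A(1) by (rule has_derivative_bounded_linear)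
  obtain w where w: "w \<noteq> 0" "\<nu> x = w /\<^sub>R norm w"
    "\<And>\<xi>. w \<bullet> \<xi> < 0 \<Longrightarrow> eventually (\<lambda>s. x + s *\<^sub>R \<xi> \<in> \<Omega>) (at_right 0)"
    using inward_cone_exists[OF assms(1-3)] x by metis
  have Aw: "A w = 0" using A(2) w(1,2) by (simp add: A.scaleR)
  have inward: "0 \<le> A \<xi>" if "w \<bullet> \<xi> < 0" for \<xi>
  proof -
    have "((\<lambda>s. (f (x + s *\<^sub>R \<xi>) - f x) / s) \<longlongrightarrow> A \<xi>) (at_right 0)"
      using ray_derivative_at_right[OF A(1) w(3)[OF that]] by (simp add: has_field_derivative_iff)
    moreover have "eventually (\<lambda>s. 0 \<le> (f (x + s *\<^sub>R \<xi>) - f x) / s) (at_right 0)"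
      using w(3)[OF that] eventually_at_right_less[of 0]
    proof eventually_elim
      case (elim s)
      then have "x + s *\<^sub>R \<xi> \<in> closure \<Omega>" using closure_subset by blast
      from min[OF this] elim(2) show ?case by simp
    qed
    ultimately show ?thesis by (intro tendsto_lowerbound) auto
  qed
  have nonneg: "0 \<le> A \<eta>" for \<eta>
  proof -
    \<comment> \<open>Subtracting \<open>c w\<close> makes the inner product with \<open>w\<close> at most \<open>- 1\<close>.\<close>
    define c where "c = (\<bar>w \<bullet> \<eta>\<bar> + 1) / (w \<bullet> w)"
    have "c * (w \<bullet> w) = \<bar>w \<bullet> \<eta>\<bar> + 1" using w(1) by (simp add: c_def)
    then have "w \<bullet> (\<eta> - c *\<^sub>R w) < 0" by (simp add: inner_diff_right)
    from inward[OF this] show ?thesis by (simp add: A.diff A.scaleR Aw)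
  qed
  have "A h = 0" for h using nonneg[of h] nonneg[of "-h"] by (simp add: A.neg)
  then have "A = (\<lambda>h. 0)" by auto
  with A(1) show ?thesis by simp
qed

lemma has_derivative_along_ray:
  fixes f :: "'a::euclidean_space \<Rightarrow> real"
  assumes "f differentiable (at (x + s *\<^sub>R \<xi>))"
  shows "((\<lambda>s. f (x + s *\<^sub>R \<xi>)) has_real_derivative
            (\<Sum>b\<in>Basis. (\<xi> \<bullet> b) * dir_deriv b f (x + s *\<^sub>R \<xi>))) (at s)"
proof -
  let ?A = "frechet_derivative f (at (x + s *\<^sub>R \<xi>))"
  have A: "(f has_derivative ?A) (at (x + s *\<^sub>R \<xi>))"
    using assms by (simp add: frechet_derivative_works)
  interpret A: bounded_linear ?A using A by (rule has_derivative_bounded_linear)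
  have "((\<lambda>s. f (x + s *\<^sub>R \<xi>)) has_derivative (\<lambda>h. ?A (h *\<^sub>R \<xi>))) (at s)"
    by (rule has_derivative_compose[where f="\<lambda>s. x + s *\<^sub>R \<xi>" and g=f])
      (auto intro!: derivative_eq_intros A)
  then have "((\<lambda>s. f (x + s *\<^sub>R \<xi>)) has_real_derivative ?A \<xi>) (at s)"
    by (simp add: has_field_derivative_def A.scaleR mult_commute_abs)
  also have "?A \<xi> = ?A (\<Sum>b\<in>Basis. (\<xi> \<bullet> b) *\<^sub>R b)"
    by (simp only: euclidean_representation)
  also have "\<dots> = (\<Sum>b\<in>Basis. (\<xi> \<bullet> b) * dir_deriv b f (x + s *\<^sub>R \<xi>))"
    by (simp only: A.sum A.scaleR dir_deriv_def real_scaleR_def)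
  finally show ?thesis .
qed

text \<open>Reduces to the one-dimensional statement for \<open>s \<mapsto> f (x + s \<xi>)\<close>. The point \<open>x\<close> may lie on the boundary,
  so \<open>H\<close> stands for the limits of the second derivatives from inside.\<close>

lemma hessian_limit_nonneg_on_inward_ray:
  fixes f :: "'a::euclidean_space \<Rightarrow> real"
  assumes diff: "\<And>y. y \<in> \<Omega> \<Longrightarrow> f differentiable (at y)"
    and diff2: "\<And>y b. y \<in> \<Omega> \<Longrightarrow> b \<in> Basis \<Longrightarrow> dir_deriv b f differentiable (at y)"
    and H: "\<And>b c. b \<in> Basis \<Longrightarrow> c \<in> Basis \<Longrightarrow>
              (dir_deriv c (dir_deriv b f) \<longlongrightarrow> H b c) (at x within \<Omega>)"
    and crit: "(f has_derivative (\<lambda>h. 0)) (at x within closure \<Omega>)"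
    and min: "\<And>y. y \<in> \<Omega> \<Longrightarrow> f x \<le> f y"
    and ray: "eventually (\<lambda>s. x + s *\<^sub>R \<xi> \<in> \<Omega>) (at_right 0)"
  shows "0 \<le> (\<Sum>b\<in>Basis. \<Sum>c\<in>Basis. (\<xi> \<bullet> b) * (\<xi> \<bullet> c) * H b c)"
proof (cases "\<xi> = 0")
  case True
  then show ?thesis by simp
next
  case False
  obtain r where r: "0 < r" "\<And>s. 0 < s \<Longrightarrow> s < r \<Longrightarrow> x + s *\<^sub>R \<xi> \<in> \<Omega>"
    using ray by (auto simp: eventually_at_right_field)
  let ?g = "\<lambda>s. f (x + s *\<^sub>R \<xi>)"
  let ?g' = "\<lambda>s. \<Sum>b\<in>Basis. (\<xi> \<bullet> b) * dir_deriv b f (x + s *\<^sub>R \<xi>)"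
  let ?g'' = "\<lambda>s. \<Sum>b\<in>Basis. \<Sum>c\<in>Basis. (\<xi> \<bullet> b) * (\<xi> \<bullet> c) * dir_deriv c (dir_deriv b f) (x + s *\<^sub>R \<xi>)"
  have "((\<lambda>s. x + s *\<^sub>R \<xi>) \<longlongrightarrow> x + 0 *\<^sub>R \<xi>) (at_right 0)"
    by (intro tendsto_intros)
  moreover have "eventually (\<lambda>s. x + s *\<^sub>R \<xi> \<in> \<Omega> \<and> x + s *\<^sub>R \<xi> \<noteq> x) (at_right 0)"
    using ray eventually_at_right_less[of 0] by eventually_elim (use False in auto)
  ultimately have "filterlim (\<lambda>s. x + s *\<^sub>R \<xi>) (at x within \<Omega>) (at_right 0)"
    by (simp add: filterlim_at)
  from filterlim_compose[OF H this] have lim: "(?g'' \<longlongrightarrow>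
      (\<Sum>b\<in>Basis. \<Sum>c\<in>Basis. (\<xi> \<bullet> b) * (\<xi> \<bullet> c) * H b c)) (at_right 0)"
    by (intro tendsto_sum tendsto_mult tendsto_const) auto
  show ?thesis
  proof (rule second_derivative_limit_nonneg[OF r(1) _ _ lim])
    show "(?g has_real_derivative ?g' s) (at s)" if "0 < s" "s < r" for s
      by (rule has_derivative_along_ray[OF diff[OF r(2)[OF that]]])
    show "(?g' has_real_derivative ?g'' s) (at s)" if "0 < s" "s < r" for s
      unfolding mult.assoc sum_distrib_left[symmetric]
      by (intro DERIV_sum DERIV_cmult has_derivative_along_ray diff2 r(2) that)
    show "(?g has_real_derivative 0) (at_right 0)"
      using ray_derivative_at_right[OF crit ray] .
    show "?g 0 \<le> ?g s" if "0 < s" "s < r" for s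
      using min[OF r(2)[OF that]] by simp
  qed
qed

text \<open>The second-order form is nonnegative on the open half-space of inward directions, by continuity on the
  closed one, and by evenness on the whole space. The basis vectors then give the diagonal entries.\<close>

lemma laplacian_limit_nonneg_at_neumann_minimum:
  fixes f :: "'a::euclidean_space \<Rightarrow> real"
  assumes "open \<Omega>" "outer_unit_normal \<Omega> \<nu>" "x \<in> closure \<Omega>"
    and diff: "\<And>y. y \<in> \<Omega> \<Longrightarrow> f differentiable (at y)"
    and diff2: "\<And>y b. y \<in> \<Omega> \<Longrightarrow> b \<in> Basis \<Longrightarrow> dir_deriv b f differentiable (at y)"
    and H: "\<And>b c. b \<in> Basis \<Longrightarrow> c \<in> Basis \<Longrightarrow>
              (dir_deriv c (dir_deriv b f) \<longlongrightarrow> H b c) (at x within \<Omega>)"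
    and neumann: "x \<in> frontier \<Omega> \<Longrightarrow> has_normal_derivative \<Omega> \<nu> f x 0"
    and min: "\<And>y. y \<in> closure \<Omega> \<Longrightarrow> f x \<le> f y"
  shows "0 \<le> (\<Sum>b\<in>Basis. H b b)"
proof -
  let ?Q = "\<lambda>\<xi>. \<Sum>b\<in>Basis. \<Sum>c\<in>Basis. (\<xi> \<bullet> b) * (\<xi> \<bullet> c) * H b c"
  obtain w where w: "w \<noteq> 0"
    "\<And>\<xi>. w \<bullet> \<xi> < 0 \<Longrightarrow> eventually (\<lambda>s. x + s *\<^sub>R \<xi> \<in> \<Omega>) (at_right 0)"
    using inward_cone_exists[OF assms(1-3)] by metis
  have crit: "(f has_derivative (\<lambda>h. 0)) (at x within closure \<Omega>)"
    by (rule derivative_zero_at_neumann_minimum[OF assms(1-3) min diff neumann])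
  have inward: "0 \<le> ?Q \<xi>" if "w \<bullet> \<xi> < 0" for \<xi>
    by (rule hessian_limit_nonneg_on_inward_ray[OF diff diff2 H crit _ w(2)[OF that]])
      (use min closure_subset in blast)+
  have half: "0 \<le> ?Q \<xi>" if "w \<bullet> \<xi> \<le> 0" for \<xi>
  proof -
    have "((\<lambda>e. ?Q (\<xi> - e *\<^sub>R w)) \<longlongrightarrow> ?Q (\<xi> - 0 *\<^sub>R w)) (at_right 0)"
      by (intro tendsto_intros)
    moreover have "eventually (\<lambda>e. 0 \<le> ?Q (\<xi> - e *\<^sub>R w)) (at_right 0)"
      using eventually_at_right_less[of 0]
    proof eventually_elim
      case (elim e)
      have "0 < e * (w \<bullet> w)" using elim w(1) by simp
      then show ?case using that by (intro inward) (simp add: inner_diff_right)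
    qed
    ultimately have "0 \<le> ?Q (\<xi> - 0 *\<^sub>R w)" by (intro tendsto_lowerbound) auto
    then show ?thesis by simp
  qed
  have all: "0 \<le> ?Q \<xi>" for \<xi>
    using half[of \<xi>] half[of "-\<xi>"] by (cases "w \<bullet> \<xi> \<le> 0") auto
  have "?Q a = H a a" if a: "a \<in> Basis" for a
  proof -
    have "?Q a = (\<Sum>b\<in>Basis. \<Sum>c\<in>Basis. if c = a then (if b = a then H b c else 0) else 0)"
      by (intro sum.cong refl) (auto simp: inner_Basis a)
    also have "\<dots> = H a a" using a by (simp add: sum.delta)
    finally show ?thesis .
  qed
  then show ?thesis using all by (metis (no_types, lifting) sum_nonneg)
qed

section \<open>The first touching point\<close>

lemma extension_tendsto:
  assumes "continuous_on (closure \<Omega> \<times> I) G" "\<forall>x\<in>\<Omega>. \<forall>t\<in>I. G (x, t) = F x t"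
    and "x \<in> closure \<Omega>" "t \<in> I"
  shows "((\<lambda>y. F y t) \<longlongrightarrow> G (x, t)) (at x within \<Omega>)"
proof -
  have "continuous_on (closure \<Omega>) (\<lambda>y. G (y, t))"
    by (rule continuous_on_compose2[OF assms(1)]) (use assms(4) in \<open>auto intro!: continuous_intros\<close>)
  then have "((\<lambda>y. G (y, t)) \<longlongrightarrow> G (x, t)) (at x within closure \<Omega>)"
    using assms(3) by (simp add: continuous_on_def)
  then have "((\<lambda>y. G (y, t)) \<longlongrightarrow> G (x, t)) (at x within \<Omega>)"
    by (rule tendsto_within_subset) (rule closure_subset)
  then show ?thesis
    by (rule Lim_transform_eventually) (use assms in \<open>auto simp: eventually_at_filter\<close>)
qed

lemma at_within_nontrivial_closure:
  fixes \<Omega> :: "'a::euclidean_space set"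
  assumes "open \<Omega>" "x \<in> closure \<Omega>"
  shows "at x within \<Omega> \<noteq> bot"
  using assms by (metis closure_def UnE interior_limit_point interior_open mem_Collect_eq
      trivial_limit_within)

text \<open>The function \<open>w x\<close> itself need not be differentiable in time when \<open>x\<close> lies on the boundary. If the
  extended derivative of \<open>w + p\<close> were positive at \<open>(x, t)\<close>, it would be positive nearby, so \<open>w y + p\<close>
  would increase up to time \<open>t\<close> for all interior \<open>y\<close> close to \<open>x\<close>. Letting \<open>y \<rightarrow> x\<close> contradicts the
  positivity before \<open>t\<close>.\<close>

lemma time_derivative_limit_at_first_touching:
  fixes w :: "'a::euclidean_space \<Rightarrow> real \<Rightarrow> real" and p p' :: "real \<Rightarrow> real"
  assumes "open \<Omega>" "open I" "x \<in> closure \<Omega>" "t \<in> I"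
    and cont: "continuous_on (closure \<Omega> \<times> I) (\<lambda>(x, t). w x t)"
    and diff: "\<And>y s. y \<in> \<Omega> \<Longrightarrow> s \<in> I \<Longrightarrow> (\<lambda>s. w y s) differentiable (at s)"
    and G: "continuous_on (closure \<Omega> \<times> I) G"
           "\<forall>y\<in>\<Omega>. \<forall>s\<in>I. G (y, s) = deriv (\<lambda>s. w y s) s"
    and p: "\<And>s. (p has_real_derivative p' s) (at s)" "continuous_on UNIV p'"
    and before: "\<And>s. s \<in> I \<Longrightarrow> s < t \<Longrightarrow> 0 < w x s + p s"
    and touch: "w x t + p t = 0"
  shows "G (x, t) \<le> - p' t"
proof (rule ccontr)
  assume "\<not> G (x, t) \<le> - p' t"
  then have pos: "0 < G (x, t) + p' t" by simp
  have "continuous_on (closure \<Omega> \<times> I) (\<lambda>z. G z + p' (snd z))"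
    by (intro continuous_intros G(1) continuous_on_compose2[OF p(2)]) auto
  then have "((\<lambda>z. G z + p' (snd z)) \<longlongrightarrow> G (x,t) + p' t) (at (x, t) within closure \<Omega> \<times> I)"
    using assms(3,4) by (force simp: continuous_on_def)
  from order_tendstoD(1)[OF this pos]
  obtain e where e: "0 < e" "\<And>z. z \<in> closure \<Omega> \<times> I \<Longrightarrow> dist z (x, t) < e \<Longrightarrow> 0 < G z + p' (snd z)"
    using pos unfolding eventually_at by (metis snd_conv)
  obtain r where r: "0 < r" "cball t r \<subseteq> I"
    using assms(2,4) open_contains_cball by blast
  define s where "s = t - min r (e/3)"
  have s: "s < t" "t - s < e/2" "{s..t} \<subseteq> I"
    using r e(1) by (auto simp: s_def cball_def dist_real_def min_def subset_iff split: if_splits)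
  then have sI: "s \<in> I" by auto
  have incr: "w y s + p s < w y t + p t" if y: "y \<in> \<Omega>" "dist y x < e/2" for y
  proof (rule DERIV_pos_imp_increasing[OF s(1)])
    fix q assume q: "s \<le> q" "q \<le> t"
    then have qI: "q \<in> I" using s by auto
    have "dist (y, q) (x, t) \<le> dist y x + dist q t"
      by (simp add: dist_Pair_Pair sqrt_sum_squares_le_sum)
    also have "\<dots> < e" using y q s by (auto simp: dist_real_def)
    finally have "0 < G (y, q) + p' q"
      using e(2)[of "(y, q)"] y qI closure_subset by auto
    moreover have "((\<lambda>s. w y s + p s) has_real_derivative (G (y, q) + p' q)) (at q)"
      using diff[OF y(1) qI] G(2) y(1) qI p(1)
      by (intro DERIV_add) (auto simp: DERIV_deriv_iff_real_differentiable)
    ultimately show "\<exists>d. ((\<lambda>s. w y s + p s) has_real_derivative d) (at q) \<and> 0 < d" by blast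
  qed
  have lim: "((\<lambda>y. w y q + p q) \<longlongrightarrow> w x q + p q) (at x within \<Omega>)" if "q \<in> I" for q
    using extension_tendsto[OF cont _ assms(3) that] by (intro tendsto_intros) auto
  have "eventually (\<lambda>y. w y s + p s \<le> w y t + p t) (at x within \<Omega>)"
    unfolding eventually_at using incr e(1) by (intro exI[of _ "e/2"]) (auto intro: less_imp_le)
  then have "w x s + p s \<le> w x t + p t"
    by (intro tendsto_le[OF _ lim lim])
      (use at_within_nontrivial_closure assms sI in auto)
  with before[OF sI s(1)] touch show False by simp
qed

text \<open>The maximum principle for a single equation: the limit of the equation at \<open>x\<close> is combined with the
  signs of its two derivative terms. The coupling with the other unknown is hidden in \<open>R\<close>, so that
  the lemma serves both equations.\<close>

lemma reaction_at_first_touching: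
  fixes w :: "'a::euclidean_space \<Rightarrow> real \<Rightarrow> real" and p p' :: "real \<Rightarrow> real"
  assumes dom: "open \<Omega>" "outer_unit_normal \<Omega> \<nu>" and "open I" "x \<in> closure \<Omega>" "t \<in> I"
    and cont: "continuous_on (closure \<Omega> \<times> I) (\<lambda>(x, t). w x t)"
    and C21: "C21 \<Omega> I w"
    and neumann: "x \<in> frontier \<Omega> \<Longrightarrow> has_normal_derivative \<Omega> \<nu> (\<lambda>y. w y t) x 0"
    and pde: "\<And>y. y \<in> \<Omega> \<Longrightarrow> \<kappa> * deriv (\<lambda>s. w y s) t = d * laplacian (\<lambda>y. w y t) y + R y"
    and "0 \<le> \<kappa>" "0 \<le> d"
    and R: "(R \<longlongrightarrow> R x) (at x within \<Omega>)"
    and p: "\<And>s. (p has_real_derivative p' s) (at s)" "continuous_on UNIV p'"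
    and before: "\<And>s. s \<in> I \<Longrightarrow> s < t \<Longrightarrow> 0 < w x s + p s"
    and touch: "w x t + p t = 0"
    and at_time: "\<And>y. y \<in> closure \<Omega> \<Longrightarrow> 0 \<le> w y t + p t"
  shows "R x \<le> - \<kappa> * p' t"
proof -
  obtain G where G: "continuous_on (closure \<Omega> \<times> I) G"
    "\<forall>y\<in>\<Omega>. \<forall>s\<in>I. G (y, s) = deriv (\<lambda>s. w y s) s"
    using C21 by (auto simp: C21_def extends_to_closure_def)
  have "\<forall>b\<in>Basis. \<forall>c\<in>Basis. \<exists>h.
      ((dir_deriv c (dir_deriv b (\<lambda>y. w y t))) \<longlongrightarrow> h) (at x within \<Omega>)"
  proof (intro ballI)
    fix b c :: 'a assume "b \<in> Basis" "c \<in> Basis"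
    then obtain K where "continuous_on (closure \<Omega> \<times> I) K"
      "\<forall>y\<in>\<Omega>. \<forall>s\<in>I. K (y, s) = dir_deriv c (dir_deriv b (\<lambda>y. w y s)) y"
      using C21 unfolding C21_def extends_to_closure_def by blast
    from extension_tendsto[OF this assms(4,5)]
    show "\<exists>h. ((dir_deriv c (dir_deriv b (\<lambda>y. w y t))) \<longlongrightarrow> h) (at x within \<Omega>)" by blast
  qed
  then obtain H where H: "\<And>b c. b \<in> Basis \<Longrightarrow> c \<in> Basis \<Longrightarrow>
      ((dir_deriv c (dir_deriv b (\<lambda>y. w y t))) \<longlongrightarrow> H b c) (at x within \<Omega>)"
    by metis
  have lap: "0 \<le> (\<Sum>b\<in>Basis. H b b)"
  proof (rule laplacian_limit_nonneg_at_neumann_minimum[OF dom assms(4) _ _ H neumann])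
    show "w x t \<le> w y t" if "y \<in> closure \<Omega>" for y
      using at_time[OF that] touch by simp
  qed (use C21 assms(5) in \<open>auto simp: C21_def\<close>)
  have time: "G (x, t) \<le> - p' t"
    by (rule time_derivative_limit_at_first_touching[OF dom(1) \<open>open I\<close> assms(4,5) cont _ G p before touch])
      (use C21 in \<open>auto simp: C21_def\<close>)
  have "((\<lambda>y. d * laplacian (\<lambda>y. w y t) y + R y) \<longlongrightarrow> d * (\<Sum>b\<in>Basis. H b b) + R x) (at x within \<Omega>)"
    unfolding laplacian_def by (intro tendsto_intros H R)
  moreover have "((\<lambda>y. \<kappa> * deriv (\<lambda>s. w y s) t) \<longlongrightarrow> \<kappa> * G (x, t)) (at x within \<Omega>)"
    by (intro tendsto_intros extension_tendsto[OF G assms(4,5)])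
  then have "((\<lambda>y. d * laplacian (\<lambda>y. w y t) y + R y) \<longlongrightarrow> \<kappa> * G (x, t)) (at x within \<Omega>)"
    by (rule Lim_transform_eventually) (use pde in \<open>auto simp: eventually_at_filter\<close>)
  ultimately have "d * (\<Sum>b\<in>Basis. H b b) + R x = \<kappa> * G (x, t)"
    using tendsto_unique[OF at_within_nontrivial_closure[OF dom(1) assms(4)]] by blast
  moreover have "0 \<le> d * (\<Sum>b\<in>Basis. H b b)" using lap \<open>0 \<le> d\<close> by simp
  moreover have "\<kappa> * G (x, t) \<le> \<kappa> * (- p' t)" by (rule mult_left_mono[OF time \<open>0 \<le> \<kappa>\<close>])
  ultimately show ?thesis by linarith
qed

lemma first_nonpositive_time:
  fixes A B :: "'a::metric_space \<Rightarrow> real \<Rightarrow> real"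
  assumes "compact X"
    and A: "continuous_on (X \<times> {0..t1}) (\<lambda>(x, t). A x t)"
    and B: "continuous_on (X \<times> {0..t1}) (\<lambda>(x, t). B x t)"
    and init: "\<And>x. x \<in> X \<Longrightarrow> 0 < A x 0 \<and> 0 < B x 0"
    and bad: "x1 \<in> X" "0 \<le> t1" "A x1 t1 \<le> 0 \<or> B x1 t1 \<le> 0"
  obtains x t where "x \<in> X" "0 < t" "t \<le> t1" "A x t = 0 \<or> B x t = 0"
    "\<And>y. y \<in> X \<Longrightarrow> 0 \<le> A y t \<and> 0 \<le> B y t"
    "\<And>y s. y \<in> X \<Longrightarrow> 0 \<le> s \<Longrightarrow> s < t \<Longrightarrow> 0 < A y s \<and> 0 < B y s"
proof -
  let ?m = "\<lambda>z. min (case z of (x, t) \<Rightarrow> A x t) (case z of (x, t) \<Rightarrow> B x t)"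
  define S where "S = {z \<in> X \<times> {0..t1}. ?m z \<in> {..0}}"
  have "continuous_on (X \<times> {0..t1}) ?m" by (intro continuous_intros A B)
  moreover have "closed (X \<times> {0..t1})"
    using \<open>compact X\<close> by (intro compact_imp_closed compact_Times) auto
  ultimately have "closed S" unfolding S_def
    using continuous_closed_preimage[of "X \<times> {0..t1}" ?m "{..0}"] by (simp add: vimage_def Int_def)
  moreover have "compact (X \<times> {0..t1})" using \<open>compact X\<close> by (intro compact_Times) auto
  moreover have "S = X \<times> {0..t1} \<inter> S" by (auto simp: S_def)
  ultimately have "compact S" by (metis compact_Int_closed)
  moreover have "(x1, t1) \<in> S" using bad by (auto simp: S_def)
  ultimately obtain z where z: "z \<in> S" "\<forall>q\<in>S. snd z \<le> snd q"
    using continuous_attains_inf[of S snd] continuous_on_snd[OF continuous_on_id] by blast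
  obtain x t where zxt: "z = (x, t)" by fastforce
  have xt: "x \<in> X" "0 \<le> t" "t \<le> t1" "A x t \<le> 0 \<or> B x t \<le> 0"
    using z(1) by (auto simp: S_def zxt)
  have "t \<noteq> 0" using init xt by force
  with xt have t: "0 < t" by simp
  have before: "0 < A y s \<and> 0 < B y s" if "y \<in> X" "0 \<le> s" "s < t" for y s
    using z(2) that xt by (force simp: S_def zxt not_le)
  have nonneg: "0 \<le> F y t"
    if y: "y \<in> X" and F: "continuous_on (X \<times> {0..t1}) (\<lambda>(x, t). F x t)"
      and pos: "\<And>s. 0 \<le> s \<Longrightarrow> s < t \<Longrightarrow> 0 < F y s" for F :: "'a \<Rightarrow> real \<Rightarrow> real" and y
  proof -
    have "continuous_on {0..t1} (\<lambda>s. F y s)"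
      using continuous_on_compose2[OF F, of "{0..t1}" "\<lambda>s. (y, s)"] y
      by (simp add: continuous_on_Pair continuous_on_const continuous_on_id image_subset_iff)
    then have "continuous_on {0..t} (\<lambda>s. F y s)"
      by (rule continuous_on_subset) (use xt in auto)
    then have "((\<lambda>s. F y s) \<longlongrightarrow> F y t) (at_left t)"
      using t by (simp add: continuous_on_Icc_at_leftD)
    moreover have "eventually (\<lambda>s. 0 \<le> F y s) (at_left t)"
      unfolding eventually_at_left_field using pos t by (auto intro!: exI[of _ 0] less_imp_le)
    ultimately show ?thesis by (intro tendsto_lowerbound) auto
  qed
  have at_t: "0 \<le> A y t \<and> 0 \<le> B y t" if "y \<in> X" for y
    using nonneg[OF that A] nonneg[OF that B] before[OF that] by blast
  show ?thesis
    using that[OF xt(1) t xt(3) _ at_t before] xt(4) at_t[OF xt(1)] by (auto intro: antisym)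
qed

section \<open>Quasi-positivity of the reaction\<close>

text \<open>With \<open>z\<close> the sum of the arguments, the rational term is at most \<open>z\<close> for \<open>z \<ge> 0\<close> and at most \<open>0\<close>
  otherwise. In both cases it is at most \<open>v + \<delta>\<close>, so the bound is uniform in \<open>v\<close>.\<close>

lemma reaction_lower_bound_u:
  assumes "0 < \<alpha>1" "0 < \<alpha>2" "0 \<le> \<delta>" "- \<delta> \<le> v"
  shows "- \<alpha>1 * \<delta> \<le> reaction \<alpha>1 \<alpha>2 (- \<delta>) v"
proof -
  define z where "z = v - \<delta>"
  have "z / (\<alpha>2 * z + 1)\<^sup>2 \<le> v + \<delta>"
  proof (cases "0 \<le> z")
    case True
    then have "1 \<le> (\<alpha>2 * z + 1)\<^sup>2" using assms by (simp add: one_le_power)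
    then have "z / (\<alpha>2 * z + 1)\<^sup>2 \<le> z / 1" using True by (intro divide_left_mono) auto
    then show ?thesis using assms by (simp add: z_def)
  next
    case False
    then have "z / (\<alpha>2 * z + 1)\<^sup>2 \<le> 0" by (simp add: divide_nonpos_nonneg)
    then show ?thesis using assms by simp
  qed
  then have "\<alpha>1 * (z / (\<alpha>2 * z + 1)\<^sup>2) \<le> \<alpha>1 * (v + \<delta>)"
    using assms(1) by (intro mult_left_mono) auto
  moreover have "reaction \<alpha>1 \<alpha>2 (- \<delta>) v = - \<alpha>1 * (z / (\<alpha>2 * z + 1)\<^sup>2 - v)"
    by (simp add: reaction_def z_def)
  ultimately show ?thesis
    unfolding right_diff_distrib distrib_left by linarith
qed

text \<open>For \<open>z \<ge> 0\<close> the rational term is nonnegative. Otherwise \<open>- 2 \<delta> \<le> z < 0\<close>, and the smallness of \<open>\<delta>\<close>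
  keeps \<open>\<alpha>2 z + 1 \<ge> 1/2\<close>, away from the pole. The term is then at least \<open>- 8 \<delta>\<close>.\<close>

lemma reaction_upper_bound_v:
  assumes "0 < \<alpha>1" "0 < \<alpha>2" "0 \<le> \<delta>" "4 * \<alpha>2 * \<delta> \<le> 1" "- \<delta> \<le> u"
  shows "reaction \<alpha>1 \<alpha>2 u (- \<delta>) \<le> 7 * \<alpha>1 * \<delta>"
proof -
  define z where "z = u - \<delta>"
  have "- 8 * \<delta> \<le> z / (\<alpha>2 * z + 1)\<^sup>2"
  proof (cases "0 \<le> z")
    case True
    then have "0 \<le> z / (\<alpha>2 * z + 1)\<^sup>2" by simp
    then show ?thesis using assms by linarith
  next
    case False
    have "\<alpha>2 * (- 2 * \<delta>) \<le> \<alpha>2 * z" using assms by (intro mult_left_mono) (auto simp: z_def)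
    then have "1/2 \<le> \<alpha>2 * z + 1" using assms by simp
    then have q: "(1/2)\<^sup>2 \<le> (\<alpha>2 * z + 1)\<^sup>2" by (intro power_mono) auto
    then have "(- z) / (\<alpha>2 * z + 1)\<^sup>2 \<le> (- z) / (1/2)\<^sup>2"
      using False by (intro divide_left_mono mult_pos_pos) (auto intro: less_le_trans[OF _ q])
    also have "\<dots> \<le> 8 * \<delta>" using assms by (simp add: z_def power2_eq_square)
    finally show ?thesis by simp
  qed
  then have "\<alpha>1 * (- 8 * \<delta>) \<le> \<alpha>1 * (z / (\<alpha>2 * z + 1)\<^sup>2)"
    using assms(1) by (intro mult_left_mono) auto
  moreover have "reaction \<alpha>1 \<alpha>2 u (- \<delta>) = - \<alpha>1 * (z / (\<alpha>2 * z + 1)\<^sup>2 + \<delta>)"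
    by (simp add: reaction_def z_def)
  ultimately show ?thesis
    unfolding distrib_left by linarith
qed

lemma reaction_tendsto:
  assumes "(f \<longlongrightarrow> a) F" "(g \<longlongrightarrow> b) F" "\<alpha>2 * (a + b) + 1 \<noteq> 0"
  shows "((\<lambda>x. reaction \<alpha>1 \<alpha>2 (f x) (g x)) \<longlongrightarrow> reaction \<alpha>1 \<alpha>2 a b) F"
  unfolding reaction_def using assms by (intro tendsto_intros) auto

section \<open>Nonnegativity\<close>

text \<open>The value of \<open>K\<close> is chosen so that \<open>K > \<alpha>1\<close> and \<open>\<tau> K > 7 \<alpha>1\<close>, which beats the constants of the two
  reaction bounds. The smallness of \<open>\<epsilon>\<close> depends on \<open>t1\<close>: it makes the perturbation admissible in
  those bounds up to time \<open>t1\<close>.\<close>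

lemma perturbed_solution_positive:
  fixes \<Omega> :: "'a::euclidean_space set"
  assumes dom: "bounded_smooth_domain \<Omega>" "outer_unit_normal \<Omega> \<nu>"
    and par: "D > 0" "\<tau> > 0" "\<alpha>1 > 0" "\<alpha>2 > 0"
    and u\<^sub>0: "\<forall>x\<in>closure \<Omega>. u\<^sub>0 x \<ge> 0" and v\<^sub>0: "\<forall>x\<in>closure \<Omega>. v\<^sub>0 x \<ge> 0"
    and sol: "classical_solution \<Omega> \<nu> D \<tau> \<alpha>1 \<alpha>2 u\<^sub>0 v\<^sub>0 T u v"
    and K: "K = 8 * \<alpha>1 * (1 + 1 / \<tau>)"
    and t1: "0 \<le> t1" "ereal t1 < T"
    and \<epsilon>: "0 < \<epsilon>" "4 * \<alpha>2 * (\<epsilon> * exp (K * t1)) \<le> 1"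
    and x1: "x1 \<in> closure \<Omega>"
  shows "0 < u x1 t1 + \<epsilon> * exp (K * t1) \<and> 0 < v x1 t1 + \<epsilon> * exp (K * t1)"
proof (rule ccontr)
  assume contr: "\<not> ?thesis"
  define I where "I = {t. 0 < t \<and> ereal t < T}"
  define p where "p t = \<epsilon> * exp (K * t)" for t
  have "open \<Omega>" and comp: "compact (closure \<Omega>)"
    using dom(1) by (auto simp: bounded_smooth_domain_def compact_closure)
  have I_open: "open I"
    unfolding I_def by (intro open_Collect_conj open_Collect_less continuous_intros)
  have K0: "0 < K" using par by (simp add: K add_pos_pos)
  have p': "(p has_real_derivative K * p s) (at s)" for s
    unfolding p_def by (auto intro!: derivative_eq_intros)
  have p'_cont: "continuous_on UNIV (\<lambda>s. K * p s)"
    unfolding p_def by (intro continuous_intros)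
  have cont0: "continuous_on (closure \<Omega> \<times> {t. 0 \<le> t \<and> ereal t < T}) (\<lambda>(x, t). w x t)"
    and C21: "C21 \<Omega> I w" if "w = u \<or> w = v" for w
    using sol that unfolding classical_solution_def I_def by auto
  have cont_I: "continuous_on (closure \<Omega> \<times> I) (\<lambda>(x, t). w x t)" if "w = u \<or> w = v" for w
    by (rule continuous_on_subset[OF cont0[OF that]]) (auto simp: I_def)
  have le_T: "ereal s < T" if "s \<le> t1" for s
    using that t1 by (metis ereal_less_eq(3) le_less_trans)
  have cont_p: "continuous_on (closure \<Omega> \<times> {0..t1}) (\<lambda>(x, t). w x t + p t)" if "w = u \<or> w = v" for w
  proof -
    have "continuous_on (closure \<Omega> \<times> {0..t1}) (\<lambda>z. (case z of (x, t) \<Rightarrow> w x t) + \<epsilon> * exp (K * snd z))"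
      by (intro continuous_intros continuous_on_subset[OF cont0[OF that]]) (auto simp: le_T)
    then show ?thesis by (simp add: p_def case_prod_unfold)
  qed
  have init: "0 < u x 0 + p 0 \<and> 0 < v x 0 + p 0" if "x \<in> closure \<Omega>" for x
    using sol u\<^sub>0 v\<^sub>0 that \<epsilon> by (simp add: classical_solution_def p_def add_nonneg_pos)
  obtain x t where x: "x \<in> closure \<Omega>" and t: "0 < t" "t \<le> t1"
    and touch: "u x t + p t = 0 \<or> v x t + p t = 0"
    and at_time: "\<And>y. y \<in> closure \<Omega> \<Longrightarrow> 0 \<le> u y t + p t \<and> 0 \<le> v y t + p t"
    and before: "\<And>y s. y \<in> closure \<Omega> \<Longrightarrow> 0 \<le> s \<Longrightarrow> s < t \<Longrightarrow> 0 < u y s + p s \<and> 0 < v y s + p s"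
    by (rule first_nonpositive_time[where A="\<lambda>x t. u x t + p t" and B="\<lambda>x t. v x t + p t",
          OF comp cont_p cont_p init x1 t1(1)])
      (use contr in \<open>auto simp: p_def not_less\<close>)
  have tI: "t \<in> I" using t le_T by (simp add: I_def)
  have "p t \<le> \<epsilon> * exp (K * t1)" using t K0 \<epsilon> by (simp add: p_def)
  then have "4 * \<alpha>2 * p t \<le> 4 * \<alpha>2 * (\<epsilon> * exp (K * t1))" using par by (intro mult_left_mono) auto
  then have \<delta>: "0 < p t" "4 * \<alpha>2 * p t \<le> 1" using \<epsilon> by (auto simp: p_def)
  have lower: "- p t \<le> u x t" "- p t \<le> v x t" using at_time[OF x] by auto
  have lim: "((\<lambda>y. w y t) \<longlongrightarrow> w x t) (at x within \<Omega>)" if "w = u \<or> w = v" for w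
    using extension_tendsto[OF cont_I[OF that] _ x tI] by auto
  \<comment> \<open>The touching values avoid the pole, so the reaction is continuous there.\<close>
  have "\<alpha>2 * (- 2 * p t) \<le> \<alpha>2 * (u x t + v x t)" using lower par by (intro mult_left_mono) auto
  then have "\<alpha>2 * (u x t + v x t) + 1 \<noteq> 0" using \<delta> by linarith
  then have lim_f: "((\<lambda>y. reaction \<alpha>1 \<alpha>2 (u y t) (v y t)) \<longlongrightarrow> reaction \<alpha>1 \<alpha>2 (u x t) (v x t)) (at x within \<Omega>)"
    by (intro reaction_tendsto lim) auto
  have K_gt: "\<alpha>1 < K" "7 * \<alpha>1 < \<tau> * K"
    using par by (auto simp: K field_simps intro: add_pos_pos mult_pos_pos)
  from touch show False
  proof
    assume u: "u x t + p t = 0"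
    have "reaction \<alpha>1 \<alpha>2 (u x t) (v x t) \<le> - 1 * (K * p t)"
      by (rule reaction_at_first_touching[where w=u and \<kappa>=1 and d=D
            and R="\<lambda>y. reaction \<alpha>1 \<alpha>2 (u y t) (v y t)",
            OF \<open>open \<Omega>\<close> dom(2) I_open x tI cont_I C21 _ _ _ _ lim_f p' p'_cont _ u])
        (use sol tI before[OF x] at_time par in \<open>auto simp: classical_solution_def I_def\<close>)
    moreover have "- \<alpha>1 * p t \<le> reaction \<alpha>1 \<alpha>2 (u x t) (v x t)"
      using reaction_lower_bound_u[of \<alpha>1 \<alpha>2 "p t" "v x t"] par \<delta> lower u
      by (simp add: add_eq_0_iff2)
    moreover have "\<alpha>1 * p t < K * p t" using K_gt \<delta> by (intro mult_strict_right_mono)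
    ultimately show False by linarith
  next
    assume v: "v x t + p t = 0"
    have "- reaction \<alpha>1 \<alpha>2 (u x t) (v x t) \<le> - \<tau> * (K * p t)"
      by (rule reaction_at_first_touching[where w=v and \<kappa>=\<tau> and d=1
            and R="\<lambda>y. - reaction \<alpha>1 \<alpha>2 (u y t) (v y t)",
            OF \<open>open \<Omega>\<close> dom(2) I_open x tI cont_I C21 _ _ _ _ tendsto_minus[OF lim_f] p' p'_cont _ v])
        (use sol tI before[OF x] at_time par in \<open>auto simp: classical_solution_def I_def\<close>)
    moreover have "reaction \<alpha>1 \<alpha>2 (u x t) (v x t) \<le> 7 * \<alpha>1 * p t"
      using reaction_upper_bound_v[of \<alpha>1 \<alpha>2 "p t" "u x t"] par \<delta> lower v
      by (simp add: add_eq_0_iff2)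
    moreover have "7 * \<alpha>1 * p t < \<tau> * K * p t" using K_gt \<delta> by (intro mult_strict_right_mono)
    ultimately show False by (simp add: mult.assoc)
  qed
qed

theorem theorem1:
  fixes \<Omega> :: "(real ^ 'N) set" and \<nu> :: "real ^ 'N \<Rightarrow> real ^ 'N"
    and D \<tau> \<alpha>1 \<alpha>2 :: real
    and u\<^sub>0 v\<^sub>0 :: "real ^ 'N \<Rightarrow> real"
    and T :: ereal
    and u v :: "real ^ 'N \<Rightarrow> real \<Rightarrow> real"
  assumes "bounded_smooth_domain \<Omega>"
    and "outer_unit_normal \<Omega> \<nu>"
    and "D > 0" "\<tau> > 0" "\<alpha>1 > 0" "\<alpha>2 > 0"
    and "smooth_on_closed u\<^sub>0 (closure \<Omega>)" "\<forall>x\<in>closure \<Omega>. u\<^sub>0 x \<ge> 0"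
    and "smooth_on_closed v\<^sub>0 (closure \<Omega>)" "\<forall>x\<in>closure \<Omega>. v\<^sub>0 x \<ge> 0"
    and "0 < T"
    and "classical_solution \<Omega> \<nu> D \<tau> \<alpha>1 \<alpha>2 u\<^sub>0 v\<^sub>0 T u v"
  shows "\<forall>t. 0 \<le> t \<and> ereal t < T \<longrightarrow> (\<forall>x\<in>closure \<Omega>. u x t \<ge> 0 \<and> v x t \<ge> 0)"
proof (intro allI impI ballI)
  fix t x assume t: "0 \<le> t \<and> ereal t < T" and x: "x \<in> closure \<Omega>"
  define K where "K = 8 * \<alpha>1 * (1 + 1 / \<tau>)"
  have lim: "((\<lambda>\<epsilon>. c + \<epsilon> * exp (K * t)) \<longlongrightarrow> c) (at_right 0)" for c
    by (auto intro!: tendsto_eq_intros)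
  have "((\<lambda>\<epsilon>. 4 * \<alpha>2 * (\<epsilon> * exp (K * t))) \<longlongrightarrow> 0) (at_right 0)"
    by (auto intro!: tendsto_eq_intros)
  from order_tendstoD(2)[OF this, of 1]
  have small: "eventually (\<lambda>\<epsilon>. 4 * \<alpha>2 * (\<epsilon> * exp (K * t)) < 1) (at_right 0)" by simp
  have pos: "eventually (\<lambda>\<epsilon>. 0 < u x t + \<epsilon> * exp (K * t) \<and> 0 < v x t + \<epsilon> * exp (K * t)) (at_right 0)"
    using small eventually_at_right_less[of 0]
  proof eventually_elim
    case (elim \<epsilon>)
    then show ?case
      using perturbed_solution_positive[OF assms(1-6,8,10,12) K_def _ _ _ _ x] t by simp
  qed
  have "0 \<le> u x t"
    by (rule tendsto_lowerbound[OF lim]) (use pos in \<open>auto elim: eventually_mono\<close>)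
  moreover have "0 \<le> v x t"
    by (rule tendsto_lowerbound[OF lim]) (use pos in \<open>auto elim: eventually_mono\<close>)
  ultimately show "u x t \<ge> 0 \<and> v x t \<ge> 0" ..
qed

end
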